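(* For every integer $k\geq 3$, the following hold: (i) if $H=P_r\cup P_{r+l}$ with integers $r,l\geq 2$, then $\operatorname{bgr}_k(P_4:H)=k\left(\lfloor r/2\rfloor+\lfloor (r+l)/2\rfloor\right)-k+1$; (ii) if $H=C_{2l_1}\cup C_{2l_2}$ with integers $l_1,l_2\geq 2$, then $\operatorname{bgr}_k(P_4:H)=k(l_1+l_2)-k+1$; (iii) if $H=P_m\cup C_{2l}$ with integers $m,l\geq 2$, then $\operatorname{bgr}_k(P_4:H)=k\left(l+\lfloor m/2\rfloor\right)-k+1$.
   Context: All graphs are finite, simple and undirected. $P_n$ and $C_n$ denote the path and the cycle on $n$ vertices, and $\cup$ denotes the (vertex-)disjoint union of graphs. A $k$-edge-coloring (not necessarily proper) is exact if all $k$ colors are used at least once. A copy of a graph in an edge-colored graph is a (not necessarily induced) subgraph isomorphic to it; it is rainbow if no two of its edges have the same color and monochromatic if all its edges have the same color. The $k$-colored bipartite Gallai-Ramsey number $\operatorname{bgr}_k(G:H)$ is the minimum integer $n$ such that $n^2\geq k$ and for every $N\geq n$, every exact $k$-edge-coloring of the complete bipartite graph $K_{N,N}$ contains either a rainbow copy of $G$ or a monochromatic copy of $H$. *)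

theory Defs imports Main begin

text \<open>A graph is a pair of a vertex set and a set of edges, an edge being a two-element set of
  vertices.\<close>

type_synonym 'a graph = "'a set \<times> 'a set set"

abbreviation verts :: "'a graph \<Rightarrow> 'a set" where "verts \<equiv> fst"
abbreviation edges :: "'a graph \<Rightarrow> 'a set set" where "edges \<equiv> snd"

definition simple_graph :: "'a graph \<Rightarrow> bool" where
  "simple_graph G \<longleftrightarrow> finite (verts G) \<and> (\<forall>e\<in>edges G. e \<subseteq> verts G \<and> card e = 2)"

definition path_graph :: "nat \<Rightarrow> nat graph" where
  "path_graph n = ({..<n}, {{i, Suc i} |i. Suc i < n})"

text \<open>A simple graph, namely the cycle on \<open>n\<close> vertices, for \<open>n \<ge> 3\<close> only.\<close>

definition cycle_graph :: "nat \<Rightarrow> nat graph" where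
  "cycle_graph n = ({..<n}, {{i, Suc i mod n} |i. i < n})"

definition disjoint_union :: "'a graph \<Rightarrow> 'b graph \<Rightarrow> ('a + 'b) graph" where
  "disjoint_union G H =
     (verts G <+> verts H, (\<lambda>e. Inl ` e) ` edges G \<union> (\<lambda>e. Inr ` e) ` edges H)"

definition complete_bipartite :: "nat \<Rightarrow> nat \<Rightarrow> (nat + nat) graph" where
  "complete_bipartite m n = ({..<m} <+> {..<n}, {{Inl i, Inr j} |i j. i < m \<and> j < n})"

definition subgraph :: "'a graph \<Rightarrow> 'a graph \<Rightarrow> bool" where
  "subgraph S K \<longleftrightarrow> simple_graph S \<and> verts S \<subseteq> verts K \<and> edges S \<subseteq> edges K"

definition isomorphic :: "'a graph \<Rightarrow> 'b graph \<Rightarrow> bool" where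
  "isomorphic G H \<longleftrightarrow> (\<exists>f. bij_betw f (verts G) (verts H) \<and>
     (\<forall>u\<in>verts G. \<forall>v\<in>verts G. {u, v} \<in> edges G \<longleftrightarrow> {f u, f v} \<in> edges H))"

definition is_copy :: "'a graph \<Rightarrow> 'b graph \<Rightarrow> 'a graph \<Rightarrow> bool" where
  "is_copy S G K \<longleftrightarrow> subgraph S K \<and> isomorphic S G"

text \<open>Colors are \<open>1, \<dots>, k\<close>; only the values of a coloring on the edges of the graph matter.\<close>

definition exact_edge_coloring :: "nat \<Rightarrow> 'a graph \<Rightarrow> ('a set \<Rightarrow> nat) \<Rightarrow> bool" where
  "exact_edge_coloring k G c \<longleftrightarrow> c ` edges G = {1..k}"

definition rainbow :: "('a set \<Rightarrow> nat) \<Rightarrow> 'a graph \<Rightarrow> bool" where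
  "rainbow c S \<longleftrightarrow> inj_on c (edges S)"

definition monochromatic :: "('a set \<Rightarrow> nat) \<Rightarrow> 'a graph \<Rightarrow> bool" where
  "monochromatic c S \<longleftrightarrow> (\<forall>e\<in>edges S. \<forall>e'\<in>edges S. c e = c e')"

definition bgr_property :: "nat \<Rightarrow> 'a graph \<Rightarrow> 'b graph \<Rightarrow> nat \<Rightarrow> bool" where
  "bgr_property k G H N \<longleftrightarrow>
     (\<forall>c. exact_edge_coloring k (complete_bipartite N N) c \<longrightarrow>
        (\<exists>S. is_copy S G (complete_bipartite N N) \<and> rainbow c S) \<or>
        (\<exists>S. is_copy S H (complete_bipartite N N) \<and> monochromatic c S))"

text \<open>On \<^typ>\<open>nat\<close>, \<^const>\<open>Inf\<close> is the minimum of a nonempty set, and \<open>0\<close> on the empty set. As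
  \<open>n\<^sup>2 \<ge> k\<close> rules out \<open>0\<close> for \<open>k \<ge> 1\<close>, a positive value of \<open>bgr k G H\<close> is an attained minimum.\<close>

definition bgr :: "nat \<Rightarrow> 'a graph \<Rightarrow> 'b graph \<Rightarrow> nat" where
  "bgr k G H = Inf {n. n\<^sup>2 \<ge> k \<and> (\<forall>N\<ge>n. bgr_property k G H N)}"

end

theory Submission imports Defs begin

text \<open>
  Two facts give all three formulas at once.

  Colorings: a path \<open>P\<^sub>4\<close> in \<open>K\<^sub>N\<^sub>,\<^sub>N\<close> is a four-cycle with one edge removed, and a four-cycle with
  three or more colors contains a rainbow \<open>P\<^sub>4\<close> (keep three edges of different colors). So a coloring without
  rainbow \<open>P\<^sub>4\<close> has at most two colors on every four-cycle. With at least three colors in total this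
  forces a very rigid shape: on one of the two sides, the color of an edge depends only on its
  endpoint on that side (\<open>monochromatic_stars\<close>). Each color class is then a complete bipartite graph
  whose one side is a full side of \<open>K\<^sub>N\<^sub>,\<^sub>N\<close> and whose other side is a block of a partition.

  Targets: paths, even cycles and their disjoint unions have a bipartition with sides \<open>A\<close>, \<open>B\<close> and a
  matching that covers \<open>A\<close>. With \<open>s = |A|\<close>, such a graph fits into a color class as soon as the block
  has \<open>s\<close> vertices (and \<open>N \<ge> |B|\<close>), and never if it has fewer, because the \<open>s\<close> disjoint edges of the
  matching need distinct vertices of the block. By the pigeonhole principle a block with \<open>s\<close> vertices
  is unavoidable exactly when \<open>N > k (s - 1)\<close>, whence the value \<open>k (s - 1) + 1\<close>
  (\<open>bgr_P4_saturating_bipartition\<close>). For \<open>P\<^sub>n\<close> one has \<open>s = n div 2\<close>, for the cycle on \<open>2 l\<close> vertices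
  \<open>s = l\<close>, and these numbers add up in a disjoint union.
\<close>

section \<open>Copies as images of embeddings\<close>

definition embedding :: "('b \<Rightarrow> 'a) \<Rightarrow> 'b graph \<Rightarrow> 'a graph \<Rightarrow> bool" where
  "embedding f H K \<longleftrightarrow> inj_on f (verts H) \<and> f ` verts H \<subseteq> verts K \<and> (`) f ` edges H \<subseteq> edges K"

lemma simple_graph_edgeE:
  assumes "simple_graph H" "e \<in> edges H"
  obtains u v where "e = {u, v}" "u \<noteq> v" "u \<in> verts H" "v \<in> verts H"
  using assms unfolding simple_graph_def by (metis card_2_iff insert_subset)

lemma embedding_of_copy:
  assumes copy: "is_copy S H K" and H: "simple_graph H"
  obtains f where "embedding f H K" "(`) f ` edges H = edges S"
proof -
  from copy obtain g where S: "simple_graph S" "verts S \<subseteq> verts K" "edges S \<subseteq> edges K"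
    and g: "bij_betw g (verts S) (verts H)"
    and iso: "\<And>u v. u \<in> verts S \<Longrightarrow> v \<in> verts S \<Longrightarrow> {u, v} \<in> edges S \<longleftrightarrow> {g u, g v} \<in> edges H"
    unfolding is_copy_def subgraph_def isomorphic_def by blast
  define f where "f = the_inv_into (verts S) g"
  have f: "bij_betw f (verts H) (verts S)"
    unfolding f_def using g by (rule bij_betw_the_inv_into)
  have gf: "g (f x) = x" if "x \<in> verts H" for x
    using that g unfolding f_def bij_betw_def by (metis f_the_inv_into_f)
  have fg: "f (g x) = x" if "x \<in> verts S" for x
    using that g unfolding f_def bij_betw_def by (metis the_inv_into_f_f)
  have fS: "f x \<in> verts S" if "x \<in> verts H" for x
    using that f by (auto simp: bij_betw_def)
  have gH: "g x \<in> verts H" if "x \<in> verts S" for x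
    using that g by (auto simp: bij_betw_def)
  have edges: "(`) f ` edges H = edges S"
  proof (intro equalityI subsetI)
    fix e assume "e \<in> (`) f ` edges H"
    then obtain d where d: "d \<in> edges H" "e = f ` d" by blast
    obtain u v where "d = {u, v}" "u \<in> verts H" "v \<in> verts H"
      using simple_graph_edgeE[OF H d(1)] by metis
    then show "e \<in> edges S" using d iso[of "f u" "f v"] gf fS by simp
  next
    fix e assume e: "e \<in> edges S"
    then obtain u v where uv: "e = {u, v}" "u \<in> verts S" "v \<in> verts S"
      using simple_graph_edgeE[OF S(1)] by metis
    then have "{g u, g v} \<in> edges H" using e iso by simp
    moreover have "e = f ` {g u, g v}" using uv fg by simp
    ultimately show "e \<in> (`) f ` edges H" by blast
  qed
  moreover have "embedding f H K"
    unfolding embedding_def using edges f S by (auto simp: bij_betw_def)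
  ultimately show thesis using that by blast
qed

lemma copy_of_embedding:
  assumes f: "embedding f H K" and H: "simple_graph H"
  shows "is_copy (f ` verts H, (`) f ` edges H) H K"
proof -
  let ?S = "(f ` verts H, (`) f ` edges H)"
  have inj: "inj_on f (verts H)" using f by (simp add: embedding_def)
  have "card (f ` e) = 2" if "e \<in> edges H" for e
    using that H inj unfolding simple_graph_def by (metis card_image inj_on_subset)
  then have "simple_graph ?S"
    using H unfolding simple_graph_def by auto
  then have "subgraph ?S K"
    using f by (auto simp: subgraph_def embedding_def)
  moreover have "isomorphic ?S H"
    unfolding isomorphic_def
  proof (intro exI conjI ballI)
    let ?g = "the_inv_into (verts H) f"
    show "bij_betw ?g (verts ?S) (verts H)"
      using inj by (simp add: bij_betw_the_inv_into inj_on_imp_bij_betw)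
    fix u v assume "u \<in> verts ?S" "v \<in> verts ?S"
    then obtain x y where xy: "x \<in> verts H" "y \<in> verts H" "u = f x" "v = f y" by auto
    have "f ` {x, y} \<in> (`) f ` edges H \<longleftrightarrow> {x, y} \<in> edges H"
    proof
      assume "f ` {x, y} \<in> (`) f ` edges H"
      then obtain e where e: "e \<in> edges H" "f ` {x, y} = f ` e" by blast
      moreover have "e \<subseteq> verts H" using H e by (simp add: simple_graph_def)
      ultimately have "{x, y} = e"
        using inj_on_image_eq_iff[OF inj, of "{x, y}" e] xy by simp
      then show "{x, y} \<in> edges H" using e by simp
    qed blast
    then show "{u, v} \<in> edges ?S \<longleftrightarrow> {?g u, ?g v} \<in> edges H"
      using xy inj by (simp add: the_inv_into_f_f)
  qed
  ultimately show ?thesis by (simp add: is_copy_def)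
qed

lemma ex_rainbow_copy_iff:
  assumes "simple_graph G"
  shows "(\<exists>S. is_copy S G K \<and> rainbow c S) \<longleftrightarrow> (\<exists>f. embedding f G K \<and> inj_on c ((`) f ` edges G))"
    (is "?L \<longleftrightarrow> ?R")
proof
  assume ?L
  then obtain S where S: "is_copy S G K" "rainbow c S" by blast
  obtain f where "embedding f G K" "(`) f ` edges G = edges S"
    using embedding_of_copy[OF S(1) assms] .
  then show ?R using S(2) unfolding rainbow_def by metis
next
  assume ?R
  then obtain f where f: "embedding f G K" "inj_on c ((`) f ` edges G)" by blast
  then have "rainbow c (f ` verts G, (`) f ` edges G)" by (simp add: rainbow_def)
  then show ?L using copy_of_embedding[OF f(1) assms] by blast
qed

lemma ex_monochromatic_copy_iff:
  assumes "simple_graph H"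
  shows "(\<exists>S. is_copy S H K \<and> monochromatic c S) \<longleftrightarrow>
    (\<exists>f. embedding f H K \<and> (\<forall>d\<in>edges H. \<forall>e\<in>edges H. c (f ` d) = c (f ` e)))"
    (is "?L \<longleftrightarrow> ?R")
proof
  assume ?L
  then obtain S where S: "is_copy S H K" "monochromatic c S" by blast
  obtain f where f: "embedding f H K" "(`) f ` edges H = edges S"
    using embedding_of_copy[OF S(1) assms] .
  have "f ` e \<in> edges S" if "e \<in> edges H" for e
    unfolding f(2)[symmetric] using that by (rule imageI)
  then have "\<forall>d\<in>edges H. \<forall>e\<in>edges H. c (f ` d) = c (f ` e)"
    using S(2) unfolding monochromatic_def by blast
  then show ?R using f(1) by blast
next
  assume ?R
  then obtain f where f: "embedding f H K"
    "\<forall>d\<in>edges H. \<forall>e\<in>edges H. c (f ` d) = c (f ` e)" by blast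
  then have "monochromatic c (f ` verts H, (`) f ` edges H)"
    unfolding monochromatic_def snd_conv by blast
  then show ?L using copy_of_embedding[OF f(1) assms] by blast
qed


section \<open>Colorings of complete bipartite graphs without rainbow \<open>P\<^sub>4\<close>\<close>

lemma edges_path_graph_4: "edges (path_graph 4) = {{0, 1}, {1, 2}, {2, 3}}"
proof -
  have "{{i, Suc i} |i. Suc i < 4} = (\<lambda>i. {i, Suc i}) ` {0, 1, 2}" by auto
  then show ?thesis by (simp add: path_graph_def eval_nat_numeral)
qed

lemma verts_path_graph_4: "verts (path_graph 4) = {0, 1, 2, 3}"
  by (auto simp: path_graph_def)

lemma simple_path_graph: "simple_graph (path_graph n)"
  by (auto simp: simple_graph_def path_graph_def)

text \<open>For fixed \<open>u \<noteq> u'\<close> and \<open>v \<noteq> v'\<close>, the four ways of exchanging the names within these pairs give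
  the four ways of removing an edge from the four-cycle on \<open>u\<close>, \<open>v\<close>, \<open>u'\<close>, \<open>v'\<close>. So the conclusion,
  for all \<open>u\<close>, \<open>u'\<close>, \<open>v\<close>, \<open>v'\<close>, forbids three colors on a four-cycle.\<close>

lemma no_rainbow_P4_imp:
  assumes no: "\<nexists>S. is_copy S (path_graph 4) (complete_bipartite m n) \<and> rainbow c S"
    and uv: "u < m" "u' < m" "v < n" "v' < n" "u \<noteq> u'" "v \<noteq> v'"
  shows "\<not> distinct [c {Inl u, Inr v}, c {Inl u', Inr v}, c {Inl u', Inr v'}]"
proof
  assume dist: "distinct [c {Inl u, Inr v}, c {Inl u', Inr v}, c {Inl u', Inr v'}]"
  define f :: "nat \<Rightarrow> nat + nat" where
    "f i = (if i = 0 then Inl u else if i = 1 then Inr v else if i = 2 then Inl u' else Inr v')" for i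
  have im: "(`) f ` edges (path_graph 4)
      = {{Inl u, Inr v}, {Inl u', Inr v}, {Inl u', Inr v'}}"
    unfolding edges_path_graph_4 by (simp add: f_def insert_commute)
  have "embedding f (path_graph 4) (complete_bipartite m n)"
    unfolding embedding_def im verts_path_graph_4
    using uv by (auto simp: f_def complete_bipartite_def)
  moreover have "inj_on c ((`) f ` edges (path_graph 4))"
    unfolding im using dist by auto
  ultimately show False
    using no ex_rainbow_copy_iff[OF simple_path_graph] by blast
qed

text \<open>A vertex \<open>u\<close> that sees two colors sees a third one as well: an edge \<open>x y\<close> of a third color would
  otherwise span a three-colored four-cycle together with \<open>u\<close>. Once \<open>u\<close> sees three colors, the
  four-cycles through \<open>u\<close>, \<open>u'\<close> and \<open>v\<close> leave \<open>d u' v\<close> only the value \<open>d u v\<close>: for two neighbors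
  \<open>w\<close> of \<open>u\<close> whose colors differ from each other and from \<open>d u v\<close>, they allow only the colors in
  \<open>{d u v, d u w}\<close>, and these two sets meet in \<open>d u v\<close> alone.\<close>

lemma monochromatic_stars:
  fixes d :: "'u \<Rightarrow> 'v \<Rightarrow> 'c"
  assumes path: "\<And>u u' v v'. u \<in> U \<Longrightarrow> u' \<in> U \<Longrightarrow> v \<in> V \<Longrightarrow> v' \<in> V \<Longrightarrow> u \<noteq> u' \<Longrightarrow> v \<noteq> v' \<Longrightarrow>
      \<not> distinct [d u v, d u' v, d u' v']"
    and colors: "card ((\<lambda>(u, v). d u v) ` (U \<times> V)) \<ge> 3"
  shows "(\<forall>u\<in>U. \<forall>v\<in>V. \<forall>v'\<in>V. d u v = d u v') \<or> (\<forall>v\<in>V. \<forall>u\<in>U. \<forall>u'\<in>U. d u v = d u' v)"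
proof (rule disjCI)
  assume "\<not> (\<forall>v\<in>V. \<forall>u\<in>U. \<forall>u'\<in>U. d u v = d u' v)"
  then have not_second: "\<exists>v\<in>V. \<exists>u\<in>U. \<exists>u'\<in>U. d u v \<noteq> d u' v" by blast
  show "\<forall>u\<in>U. \<forall>v\<in>V. \<forall>v'\<in>V. d u v = d u v'"
  proof (rule ccontr)
    assume "\<not> (\<forall>u\<in>U. \<forall>v\<in>V. \<forall>v'\<in>V. d u v = d u v')"
    then obtain u v1 v2 where u: "u \<in> U" and v12: "v1 \<in> V" "v2 \<in> V" "d u v1 \<noteq> d u v2" by blast
    have "\<not> (\<lambda>(u, v). d u v) ` (U \<times> V) \<subseteq> {d u v1, d u v2}"
    proof
      assume "(\<lambda>(u, v). d u v) ` (U \<times> V) \<subseteq> {d u v1, d u v2}"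
      then have "card ((\<lambda>(u, v). d u v) ` (U \<times> V)) \<le> card {d u v1, d u v2}"
        by (intro card_mono) auto
      then show False using colors v12 by simp
    qed
    then obtain x y where xy: "x \<in> U" "y \<in> V" "d x y \<noteq> d u v1" "d x y \<noteq> d u v2" by auto
    have "d u y \<noteq> d u v1"
    proof
      assume "d u y = d u v1"
      moreover from this have "x \<noteq> u" "y \<noteq> v2" using v12 xy by auto
      ultimately show False using path[of x u y v2] u v12 xy by auto
    qed
    moreover have "d u y \<noteq> d u v2"
    proof
      assume "d u y = d u v2"
      moreover from this have "x \<noteq> u" "y \<noteq> v1" using v12 xy by auto
      ultimately show False using path[of x u y v1] u v12 xy by auto
    qed
    ultimately have three: "distinct [d u v1, d u v2, d u y]" using v12 by simp
    have same: "d u' v = d u v" if "u' \<in> U" "v \<in> V" for u' v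
    proof (cases "u' = u")
      case False
      have allowed: "d u' v = d u v \<or> d u' v = d u w" if "w \<in> V" "d u w \<noteq> d u v" for w
        using path[of u' u v w] \<open>u' \<in> U\<close> \<open>v \<in> V\<close> False u that by auto
      have "\<exists>w\<in>{v1, v2, y}. \<exists>w'\<in>{v1, v2, y}. distinct [d u v, d u w, d u w']"
        using three by auto
      then obtain w w' where "w \<in> V" "w' \<in> V" "distinct [d u v, d u w, d u w']"
        using v12 xy by blast
      then show ?thesis using allowed[of w] allowed[of w'] by auto
    qed simp
    show False using not_second same by metis
  qed
qed


section \<open>Bipartite graphs with one side covered by a matching\<close>

text \<open>Here \<open>\<mu>\<close> is the matching; \<open>A\<close> is a vertex cover whose size equals that of a matching, so
  \<open>s\<close> is both the matching number and the vertex cover number of \<open>H\<close>.\<close>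

definition saturating_bipartition :: "'a graph \<Rightarrow> nat \<Rightarrow> nat \<Rightarrow> bool" where
  "saturating_bipartition H s t \<longleftrightarrow> (\<exists>A B \<mu>.
     verts H = A \<union> B \<and> A \<inter> B = {} \<and> finite A \<and> finite B \<and> card A = s \<and> card B = t \<and>
     (\<forall>e\<in>edges H. \<exists>a\<in>A. \<exists>b\<in>B. e = {a, b}) \<and>
     inj_on \<mu> A \<and> (\<forall>a\<in>A. \<mu> a \<in> B \<and> {a, \<mu> a} \<in> edges H))"

lemma saturating_bipartitionE:
  assumes "saturating_bipartition H s t"
  obtains A B \<mu> where "verts H = A \<union> B" "A \<inter> B = {}" "finite A" "finite B" "card A = s" "card B = t"
    "\<And>e. e \<in> edges H \<Longrightarrow> \<exists>a\<in>A. \<exists>b\<in>B. e = {a, b}"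
    "inj_on \<mu> A" "\<And>a. a \<in> A \<Longrightarrow> \<mu> a \<in> B" "\<And>a. a \<in> A \<Longrightarrow> {a, \<mu> a} \<in> edges H"
proof -
  obtain A B \<mu> where "verts H = A \<union> B" "A \<inter> B = {}" "finite A" "finite B" "card A = s" "card B = t"
    "\<forall>e\<in>edges H. \<exists>a\<in>A. \<exists>b\<in>B. e = {a, b}" "inj_on \<mu> A"
    "\<forall>a\<in>A. \<mu> a \<in> B \<and> {a, \<mu> a} \<in> edges H"
    using assms unfolding saturating_bipartition_def by (elim exE conjE) (rule that)
  then show thesis by (intro that[of A B \<mu>]) blast+
qed

lemma saturating_bipartition_simple_graph:
  assumes "saturating_bipartition H s t"
  shows "simple_graph H"
proof -
  obtain A B where AB: "verts H = A \<union> B" "A \<inter> B = {}" "finite A" "finite B"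
    and e: "\<And>e. e \<in> edges H \<Longrightarrow> \<exists>a\<in>A. \<exists>b\<in>B. e = {a, b}"
    using assms by (elim saturating_bipartitionE) blast
  have "e \<subseteq> verts H \<and> card e = 2" if "e \<in> edges H" for e
    using e[OF that] AB by (force simp: card_2_iff)
  then show ?thesis using AB by (simp add: simple_graph_def)
qed

lemma card_odd_lessThan: "card {i. i < n \<and> odd i} = n div 2"
proof -
  have "{i. i < n \<and> odd i} = (\<lambda>j. 2 * j + 1) ` {..<n div 2}"
    by (force elim!: oddE)
  then show ?thesis by (simp add: card_image inj_on_def)
qed

lemma card_even_lessThan: "card {i::nat. i < n \<and> even i} = n - n div 2"
proof -
  have "{i. i < n \<and> even i} = {..<n} - {i. i < n \<and> odd i}" by auto
  then show ?thesis by (simp add: card_Diff_subset card_odd_lessThan subset_iff)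
qed

text \<open>In paths and even cycles alike, the odd vertices form the smaller side, and \<open>i\<close> is matched with
  its predecessor.\<close>

lemma saturating_bipartition_odd:
  assumes verts: "verts H = {..<n}"
    and edges: "\<And>e. e \<in> edges H \<Longrightarrow> \<exists>i j. e = {i, j} \<and> i < n \<and> j < n \<and> odd i \<and> even j"
    and pred: "\<And>i. Suc i < n \<Longrightarrow> {i, Suc i} \<in> edges H"
  shows "saturating_bipartition H (n div 2) (n - n div 2)"
  unfolding saturating_bipartition_def
proof (intro exI conjI ballI)
  let ?A = "{i. i < n \<and> odd i}" and ?B = "{i. i < n \<and> even i}"
  show "verts H = ?A \<union> ?B" using verts by auto
  show "inj_on (\<lambda>i. i - 1) ?A" by (rule inj_onI) (auto elim!: oddE)
  fix e assume "e \<in> edges H"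
  then show "\<exists>a\<in>?A. \<exists>b\<in>?B. e = {a, b}" using edges by blast
next
  fix i assume i: "i \<in> {i. i < n \<and> odd i}"
  then show "i - 1 \<in> {i. i < n \<and> even i}" by auto
  show "{i, i - 1} \<in> edges H"
    using i pred[of "i - 1"] by (auto simp: insert_commute elim!: oddE)
qed (auto simp: card_odd_lessThan card_even_lessThan)

lemma saturating_bipartition_path:
  "saturating_bipartition (path_graph n) (n div 2) (n - n div 2)"
proof (rule saturating_bipartition_odd)
  fix e assume "e \<in> edges (path_graph n)"
  then obtain i where i: "e = {i, Suc i}" "Suc i < n" by (auto simp: path_graph_def)
  show "\<exists>i j. e = {i, j} \<and> i < n \<and> j < n \<and> odd i \<and> even j"
  proof (cases "odd i")
    case True
    then show ?thesis using i by (intro exI[of _ i] exI[of _ "Suc i"]) auto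
  next
    case False
    then show ?thesis using i by (intro exI[of _ "Suc i"] exI[of _ i]) auto
  qed
qed (auto simp: path_graph_def)

lemma saturating_bipartition_cycle:
  "saturating_bipartition (cycle_graph (2 * l)) l l"
proof -
  let ?n = "2 * l"
  have "saturating_bipartition (cycle_graph ?n) (?n div 2) (?n - ?n div 2)"
  proof (rule saturating_bipartition_odd)
    fix e assume "e \<in> edges (cycle_graph ?n)"
    then obtain i where i: "e = {i, Suc i mod ?n}" "i < ?n" by (auto simp: cycle_graph_def)
    \<comment> \<open>The edge from \<open>2 l - 1\<close> back to \<open>0\<close> joins the two sides as well, because reduction
      modulo \<open>2 l\<close> preserves parity.\<close>
    have "Suc i mod ?n < ?n" "even (Suc i mod ?n) \<longleftrightarrow> odd i"
      using i by (auto simp: dvd_mod_iff)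
    then show "\<exists>i j. e = {i, j} \<and> i < ?n \<and> j < ?n \<and> odd i \<and> even j"
      using i by (metis insert_commute)
  next
    fix i assume "Suc i < ?n"
    then have "{i, Suc i} = {i, Suc i mod ?n}" "i < ?n" by simp_all
    then show "{i, Suc i} \<in> edges (cycle_graph ?n)" by (auto simp: cycle_graph_def)
  qed (simp add: cycle_graph_def)
  then show ?thesis by simp
qed

lemma saturating_bipartition_disjoint_union:
  assumes "saturating_bipartition G s t" "saturating_bipartition H s' t'"
  shows "saturating_bipartition (disjoint_union G H) (s + s') (t + t')"
proof -
  obtain A B \<mu> where G: "verts G = A \<union> B" "A \<inter> B = {}" "finite A" "finite B" "card A = s" "card B = t"
    "\<And>e. e \<in> edges G \<Longrightarrow> \<exists>a\<in>A. \<exists>b\<in>B. e = {a, b}"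
    "inj_on \<mu> A" "\<And>a. a \<in> A \<Longrightarrow> \<mu> a \<in> B" "\<And>a. a \<in> A \<Longrightarrow> {a, \<mu> a} \<in> edges G"
    using assms(1) by (elim saturating_bipartitionE) blast
  obtain A' B' \<mu>' where H: "verts H = A' \<union> B'" "A' \<inter> B' = {}" "finite A'" "finite B'"
    "card A' = s'" "card B' = t'"
    "\<And>e. e \<in> edges H \<Longrightarrow> \<exists>a\<in>A'. \<exists>b\<in>B'. e = {a, b}"
    "inj_on \<mu>' A'" "\<And>a. a \<in> A' \<Longrightarrow> \<mu>' a \<in> B'" "\<And>a. a \<in> A' \<Longrightarrow> {a, \<mu>' a} \<in> edges H"
    using assms(2) by (elim saturating_bipartitionE) blast
  have inl: "Inl ` e \<in> edges (disjoint_union G H)" if "e \<in> edges G" for e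
    using that by (simp add: disjoint_union_def)
  have inr: "Inr ` e \<in> edges (disjoint_union G H)" if "e \<in> edges H" for e
    using that by (simp add: disjoint_union_def)
  show ?thesis
    unfolding saturating_bipartition_def
  proof (intro exI conjI ballI)
    show "verts (disjoint_union G H) = (A <+> A') \<union> (B <+> B')"
      using G H by (auto simp: disjoint_union_def)
    show "(A <+> A') \<inter> (B <+> B') = {}" using G H by auto
    show "card (A <+> A') = s + s'" "card (B <+> B') = t + t'"
      using G H by (simp_all add: card_Plus)
    show "finite (A <+> A')" "finite (B <+> B')" using G H by simp_all
    show "inj_on (map_sum \<mu> \<mu>') (A <+> A')"
      using G(8) H(8) by (auto intro!: inj_onI dest: inj_onD)
  next
    fix e assume "e \<in> edges (disjoint_union G H)"
    then consider d where "d \<in> edges G" "e = Inl ` d" | d where "d \<in> edges H" "e = Inr ` d"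
      by (auto simp: disjoint_union_def)
    then show "\<exists>a\<in>A <+> A'. \<exists>b\<in>B <+> B'. e = {a, b}"
    proof cases
      case 1
      then obtain a b where "a \<in> A" "b \<in> B" "d = {a, b}" using G(7) by blast
      then show ?thesis using 1 by (intro bexI[of _ "Inl a"] bexI[of _ "Inl b"]) auto
    next
      case 2
      then obtain a b where "a \<in> A'" "b \<in> B'" "d = {a, b}" using H(7) by blast
      then show ?thesis using 2 by (intro bexI[of _ "Inr a"] bexI[of _ "Inr b"]) auto
    qed
  next
    fix a assume "a \<in> A <+> A'"
    then show "map_sum \<mu> \<mu>' a \<in> B <+> B'" using G(9) H(9) by auto
    show "{a, map_sum \<mu> \<mu>' a} \<in> edges (disjoint_union G H)"
      using \<open>a \<in> A <+> A'\<close> inl[OF G(10)] inr[OF H(10)] by auto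
  qed
qed


section \<open>The upper bound\<close>

lemma monochromatic_copy_in_complete_pair:
  assumes H: "saturating_bipartition H s t"
    and XY: "X \<union> Y \<subseteq> verts K" "X \<inter> Y = {}" "finite X" "finite Y" "s \<le> card X" "t \<le> card Y"
    and edge: "\<And>x y. x \<in> X \<Longrightarrow> y \<in> Y \<Longrightarrow> {x, y} \<in> edges K \<and> c {x, y} = i"
  shows "\<exists>S. is_copy S H K \<and> monochromatic c S"
proof -
  obtain A B where AB: "verts H = A \<union> B" "A \<inter> B = {}" "finite A" "finite B" "card A = s" "card B = t"
    and e: "\<And>e. e \<in> edges H \<Longrightarrow> \<exists>a\<in>A. \<exists>b\<in>B. e = {a, b}"
    using H by (elim saturating_bipartitionE) blast
  obtain p where p: "p ` A \<subseteq> X" "inj_on p A"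
    using card_le_inj[of A X] AB XY by blast
  obtain q where q: "q ` B \<subseteq> Y" "inj_on q B"
    using card_le_inj[of B Y] AB XY by blast
  define f where "f x = (if x \<in> A then p x else q x)" for x
  have fA: "f a = p a" if "a \<in> A" for a using that by (simp add: f_def)
  have fB: "f b = q b" if "b \<in> B" for b using that AB by (auto simp: f_def)
  have img: "f ` e \<in> edges K \<and> c (f ` e) = i" if "e \<in> edges H" for e
  proof -
    obtain a b where "a \<in> A" "b \<in> B" "e = {a, b}" using e[OF \<open>e \<in> edges H\<close>] by blast
    then show ?thesis using edge[of "p a" "q b"] p q by (auto simp: fA fB)
  qed
  have "f ` A \<subseteq> X" "f ` B \<subseteq> Y" "inj_on f A" "inj_on f B"
    using fA fB p q by (auto simp: inj_on_def)
  then have "inj_on f (A \<union> B)" "f ` (A \<union> B) \<subseteq> verts K"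
    unfolding inj_on_Un image_Un using XY(1,2) by blast+
  then have "embedding f H K"
    unfolding embedding_def using AB img by auto
  then show ?thesis
    using img ex_monochromatic_copy_iff[OF saturating_bipartition_simple_graph[OF H]] by metis
qed

lemma pigeonhole_fiber:
  fixes g :: "nat \<Rightarrow> nat"
  assumes "g ` {..<N} \<subseteq> {1..k}" "k * (s - 1) < N"
  obtains i where "s \<le> card {v. v < N \<and> g v = i}"
proof (rule ccontr)
  assume "\<not> thesis"
  then have small: "card {v. v < N \<and> g v = i} \<le> s - 1" for i
    using that[of i] by linarith
  have "{..<N} = (\<Union>i\<in>{1..k}. {v. v < N \<and> g v = i})" using assms(1) by auto
  then have "N = card (\<Union>i\<in>{1..k}. {v. v < N \<and> g v = i})" by (metis card_lessThan)
  also have "\<dots> \<le> (\<Sum>i\<in>{1..k}. card {v. v < N \<and> g v = i})" by (rule card_UN_le) simp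
  also have "\<dots> \<le> (\<Sum>i\<in>{1..k}. s - 1)" by (rule sum_mono) (rule small)
  finally show False using assms(2) by simp
qed

lemma bgr_property_P4:
  assumes H: "saturating_bipartition H s t" and k: "3 \<le> k"
    and N: "k * (s - 1) < N" "t \<le> N"
  shows "bgr_property k (path_graph 4) H N"
  unfolding bgr_property_def
proof (intro allI impI disjCI)
  fix c :: "(nat + nat) set \<Rightarrow> nat"
  let ?K = "complete_bipartite N N"
  assume exact: "exact_edge_coloring k ?K c"
    and no_mono: "\<nexists>S. is_copy S H ?K \<and> monochromatic c S"
  define d where "d u v = c {Inl u, Inr v}" for u v
  have image: "(\<lambda>(u, v). d u v) ` ({..<N} \<times> {..<N}) = {1..k}"
  proof -
    have "(\<lambda>(u, v). d u v) ` ({..<N} \<times> {..<N}) = c ` edges ?K"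
      by (force simp: d_def complete_bipartite_def)
    then show ?thesis using exact by (simp add: exact_edge_coloring_def)
  qed
  have col: "d u v \<in> {1..k}" if "u < N" "v < N" for u v
    unfolding image[symmetric] using that by force
  have "0 < N" using N by simp
  show "\<exists>S. is_copy S (path_graph 4) ?K \<and> rainbow c S"
  proof (rule ccontr)
    assume no: "\<nexists>S. is_copy S (path_graph 4) ?K \<and> rainbow c S"
    have "(\<forall>u\<in>{..<N}. \<forall>v\<in>{..<N}. \<forall>v'\<in>{..<N}. d u v = d u v') \<or>
        (\<forall>v\<in>{..<N}. \<forall>u\<in>{..<N}. \<forall>u'\<in>{..<N}. d u v = d u' v)"
    proof (rule monochromatic_stars)
      show "3 \<le> card ((\<lambda>(u, v). d u v) ` ({..<N} \<times> {..<N}))" using image k by simp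
    qed (use no_rainbow_P4_imp[OF no] in \<open>simp add: d_def\<close>)
    then show False
    proof
      assume mono: "\<forall>u\<in>{..<N}. \<forall>v\<in>{..<N}. \<forall>v'\<in>{..<N}. d u v = d u v'"
      have "(\<lambda>u. d u 0) ` {..<N} \<subseteq> {1..k}" using col \<open>0 < N\<close> by blast
      then obtain i where i: "s \<le> card {u. u < N \<and> d u 0 = i}"
        using N(1) by (rule pigeonhole_fiber)
      let ?X = "Inl ` {u. u < N \<and> d u 0 = i} :: (nat + nat) set"
        and ?Y = "Inr ` {..<N} :: (nat + nat) set"
      have "{x, y} \<in> edges ?K \<and> c {x, y} = i" if xy: "x \<in> ?X" "y \<in> ?Y" for x y
      proof -
        obtain u v where uv: "x = Inl u" "y = Inr v" "u < N" "v < N" "d u 0 = i"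
          using xy by blast
        then have "d u v = i" using mono \<open>0 < N\<close> by blast
        then show ?thesis using uv by (auto simp: complete_bipartite_def d_def)
      qed
      then have "\<exists>S. is_copy S H ?K \<and> monochromatic c S"
        using i N by (intro monochromatic_copy_in_complete_pair[OF H, of ?X ?Y])
          (auto simp: complete_bipartite_def card_image)
      then show False using no_mono by blast
    next
      assume mono: "\<forall>v\<in>{..<N}. \<forall>u\<in>{..<N}. \<forall>u'\<in>{..<N}. d u v = d u' v"
      have "d 0 ` {..<N} \<subseteq> {1..k}" using col \<open>0 < N\<close> by blast
      then obtain i where i: "s \<le> card {v. v < N \<and> d 0 v = i}"
        using N(1) by (rule pigeonhole_fiber)
      let ?X = "Inr ` {v. v < N \<and> d 0 v = i} :: (nat + nat) set"
        and ?Y = "Inl ` {..<N} :: (nat + nat) set"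
      have "{x, y} \<in> edges ?K \<and> c {x, y} = i" if xy: "x \<in> ?X" "y \<in> ?Y" for x y
      proof -
        obtain u v where uv: "x = Inr v" "y = Inl u" "u < N" "v < N" "d 0 v = i"
          using xy by blast
        then have "d u v = i" using mono \<open>0 < N\<close> by blast
        then show ?thesis using uv by (auto simp: complete_bipartite_def d_def insert_commute)
      qed
      then have "\<exists>S. is_copy S H ?K \<and> monochromatic c S"
        using i N by (intro monochromatic_copy_in_complete_pair[OF H, of ?X ?Y])
          (auto simp: complete_bipartite_def card_image)
      then show False using no_mono by blast
    qed
  qed
qed


section \<open>The lower bound\<close>

text \<open>The extremal coloring cuts the right-hand side into \<open>k\<close> intervals of length \<open>q\<close>; the color of
  an edge is the number of the interval of its right endpoint.\<close>

definition interval_coloring :: "nat \<Rightarrow> (nat + nat) set \<Rightarrow> nat" where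
  "interval_coloring q e = Suc ((THE v. Inr v \<in> e) div q)"

lemma interval_coloring_edge [simp]:
  "interval_coloring q {Inl u, Inr v} = Suc (v div q)"
  "interval_coloring q {Inr v, Inl u} = Suc (v div q)"
  by (simp_all add: interval_coloring_def)

lemma edge_complete_bipartite_iff:
  "{x, y} \<in> edges (complete_bipartite m n) \<longleftrightarrow>
    (\<exists>u v. u < m \<and> v < n \<and> (x = Inl u \<and> y = Inr v \<or> x = Inr v \<and> y = Inl u))"
  by (auto simp: complete_bipartite_def doubleton_eq_iff)

lemma exact_interval_coloring:
  assumes "0 < q"
  shows "exact_edge_coloring k (complete_bipartite (k * q) (k * q)) (interval_coloring q)"
  unfolding exact_edge_coloring_def
proof (intro equalityI subsetI)
  fix i assume "i \<in> interval_coloring q ` edges (complete_bipartite (k * q) (k * q))"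
  then obtain v where "v < k * q" "i = Suc (v div q)"
    by (auto simp: complete_bipartite_def)
  then show "i \<in> {1..k}" using assms by (simp add: less_mult_imp_div_less Suc_leI)
next
  fix i assume i: "i \<in> {1..k}"
  let ?v = "(i - 1) * q"
  have "i - 1 < k" using i by auto
  then have v: "?v < k * q" using assms by simp
  then have "{Inl ?v, Inr ?v} \<in> edges (complete_bipartite (k * q) (k * q))"
    unfolding edge_complete_bipartite_iff by blast
  moreover have "interval_coloring q {Inl ?v, Inr ?v} = i" using i assms by simp
  ultimately show "i \<in> interval_coloring q ` edges (complete_bipartite (k * q) (k * q))"
    by (metis imageI)
qed

text \<open>One of the two inner vertices of a \<open>P\<^sub>4\<close> lies on the right, and the two path edges at it have the
  same color.\<close>

lemma interval_coloring_no_rainbow_P4: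
  "\<nexists>S. is_copy S (path_graph 4) (complete_bipartite m n) \<and> rainbow (interval_coloring q) S"
proof
  let ?K = "complete_bipartite m n" and ?c = "interval_coloring q"
  assume "\<exists>S. is_copy S (path_graph 4) ?K \<and> rainbow ?c S"
  then obtain f where f: "embedding f (path_graph 4) ?K"
    and inj: "inj_on ?c ((`) f ` edges (path_graph 4))"
    using ex_rainbow_copy_iff[OF simple_path_graph] by blast
  have im: "(`) f ` edges (path_graph 4) = {{f 0, f 1}, {f 1, f 2}, {f 2, f 3}}"
    by (simp add: edges_path_graph_4)
  have "{f 0, f 1} \<in> edges ?K" "{f 1, f 2} \<in> edges ?K" "{f 2, f 3} \<in> edges ?K"
    using f unfolding embedding_def im by simp_all
  then have "?c {f 0, f 1} = ?c {f 1, f 2} \<or> ?c {f 1, f 2} = ?c {f 2, f 3}"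
    unfolding edge_complete_bipartite_iff by auto
  then have "{f 0, f 1} = {f 1, f 2} \<or> {f 1, f 2} = {f 2, f 3}"
    using inj unfolding im by (auto dest: inj_onD)
  then have "f 0 = f 2 \<or> f 1 = f 3" by (auto simp: doubleton_eq_iff)
  then show False
    using f unfolding embedding_def verts_path_graph_4 by (auto dest: inj_onD)
qed

lemma interval_coloring_no_monochromatic:
  assumes H: "saturating_bipartition H s t" and q: "0 < q" "q < s"
  shows "\<nexists>S. is_copy S H (complete_bipartite m n) \<and> monochromatic (interval_coloring q) S"
proof
  let ?K = "complete_bipartite m n" and ?c = "interval_coloring q"
  assume "\<exists>S. is_copy S H ?K \<and> monochromatic ?c S"
  then obtain f where f: "embedding f H ?K"
    and mono: "\<forall>d\<in>edges H. \<forall>e\<in>edges H. ?c (f ` d) = ?c (f ` e)"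
    unfolding ex_monochromatic_copy_iff[OF saturating_bipartition_simple_graph[OF H]] by blast
  obtain A B \<mu> where AB: "verts H = A \<union> B" "A \<inter> B = {}" "finite A" "card A = s"
    and \<mu>: "inj_on \<mu> A" "\<And>a. a \<in> A \<Longrightarrow> \<mu> a \<in> B" "\<And>a. a \<in> A \<Longrightarrow> {a, \<mu> a} \<in> edges H"
    using H by (elim saturating_bipartitionE) blast
  have inj: "inj_on f (A \<union> B)" using f AB by (simp add: embedding_def)
  \<comment> \<open>\<open>g a\<close> is the right endpoint of the image of the matching edge at \<open>a\<close>; these endpoints all lie
    in one interval, which has only \<open>q < s\<close> elements.\<close>
  have "\<exists>v. (f a = Inr v \<or> f (\<mu> a) = Inr v) \<and> ?c (f ` {a, \<mu> a}) = Suc (v div q)"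
    if "a \<in> A" for a
  proof -
    have "f ` {a, \<mu> a} \<in> edges ?K" using f \<mu>(3)[OF that] unfolding embedding_def by blast
    then show ?thesis by (auto simp: edge_complete_bipartite_iff)
  qed
  then obtain g where g: "\<And>a. a \<in> A \<Longrightarrow> f a = Inr (g a) \<or> f (\<mu> a) = Inr (g a)"
    and cg: "\<And>a. a \<in> A \<Longrightarrow> ?c (f ` {a, \<mu> a}) = Suc (g a div q)"
    by metis
  have "inj_on g A"
  proof (rule inj_onI)
    fix a a' assume a: "a \<in> A" "a' \<in> A" "g a = g a'"
    then have "\<exists>x\<in>{a, \<mu> a}. \<exists>y\<in>{a', \<mu> a'}. f x = f y"
      using g[of a] g[of a'] by auto
    then obtain x y where xy: "x \<in> {a, \<mu> a}" "y \<in> {a', \<mu> a'}" "f x = f y" by blast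
    then have "x = y" using inj a \<mu>(2) by (intro inj_onD[OF inj]) auto
    then show "a = a'" using xy a \<mu> AB by (auto dest: inj_onD)
  qed
  moreover obtain a0 where a0: "a0 \<in> A" using AB q by fastforce
  have "g ` A \<subseteq> {g a0 div q * q..<g a0 div q * q + q}"
  proof
    fix v assume "v \<in> g ` A"
    then obtain a where a: "a \<in> A" "v = g a" by blast
    then have "v div q = g a0 div q" using cg mono \<mu>(3) a0 by (metis Suc_inject)
    then show "v \<in> {g a0 div q * q..<g a0 div q * q + q}"
      using q div_mult_mod_eq[of v q] mod_less_divisor[of q v]
      by (metis add_strict_left_mono atLeastLessThan_iff le_add1)
  qed
  ultimately have "card A \<le> card {g a0 div q * q..<g a0 div q * q + q}"
    by (intro card_inj_on_le) auto
  then show False using AB q by simp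
qed


section \<open>The Gallai-Ramsey number\<close>

text \<open>The hypothesis on \<open>t\<close> makes the larger side of \<open>H\<close> fit into a full side of \<open>K\<^sub>N\<^sub>,\<^sub>N\<close> at the
  threshold; \<open>s \<ge> 2\<close> ensures that the intervals of the extremal coloring are nonempty, so that it uses
  all \<open>k\<close> colors.\<close>

lemma bgr_P4_saturating_bipartition:
  assumes H: "saturating_bipartition H s t" and k: "3 \<le> k" and s: "2 \<le> s"
    and t: "t \<le> k * (s - 1) + 1"
  shows "bgr k (path_graph 4) H = k * (s - 1) + 1"
proof -
  let ?m = "k * (s - 1) + 1"
  have "{n. n\<^sup>2 \<ge> k \<and> (\<forall>N\<ge>n. bgr_property k (path_graph 4) H N)} = {?m..}"
  proof (intro equalityI subsetI)
    fix n assume "n \<in> {n. n\<^sup>2 \<ge> k \<and> (\<forall>N\<ge>n. bgr_property k (path_graph 4) H N)}"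
    then have large: "\<And>N. n \<le> N \<Longrightarrow> bgr_property k (path_graph 4) H N" by blast
    have "\<not> bgr_property k (path_graph 4) H (k * (s - 1))"
    proof -
      have q: "0 < s - 1" "s - 1 < s" using s by simp_all
      show ?thesis
        unfolding bgr_property_def
        using exact_interval_coloring[OF q(1)] interval_coloring_no_rainbow_P4
          interval_coloring_no_monochromatic[OF H q] by blast
    qed
    then have "\<not> n \<le> k * (s - 1)" using large by blast
    then show "n \<in> {?m..}" by simp
  next
    fix n assume n: "n \<in> {?m..}"
    have "k \<le> k * (s - 1)" using s by auto
    also have "\<dots> \<le> n" using n by simp
    also have "n \<le> n\<^sup>2" by (simp add: power2_eq_square)
    finally have "k \<le> n\<^sup>2" .
    moreover have "bgr_property k (path_graph 4) H N" if "n \<le> N" for N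
      using that n t by (intro bgr_property_P4[OF H k]) auto
    ultimately show "n \<in> {n. n\<^sup>2 \<ge> k \<and> (\<forall>N\<ge>n. bgr_property k (path_graph 4) H N)}" by blast
  qed
  then show ?thesis unfolding bgr_def by (simp add: cInf_eq_minimum[of ?m])
qed

text \<open>Two components, each with sides differing by at most one, give \<open>t \<le> s + 2\<close>, and for
  \<open>s \<ge> 2\<close> this is at most \<open>3 (s - 1) + 1\<close>.\<close>

lemma bgr_P4_nearly_balanced:
  assumes H: "saturating_bipartition H s t" and k: "3 \<le> k" and s: "2 \<le> s" and t: "t \<le> s + 2"
  shows "bgr k (path_graph 4) H = k * s - k + 1"
proof -
  have "3 * (s - 1) \<le> k * (s - 1)" using k by (rule mult_le_mono1)
  then have "t \<le> k * (s - 1) + 1" using s t by linarith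
  then show ?thesis
    using bgr_P4_saturating_bipartition[OF H k s] by (simp add: diff_mult_distrib2)
qed

theorem theorem3p1:
  fixes k :: nat
  assumes "k \<ge> 3"
  shows
   "(\<forall>r l :: nat. r \<ge> 2 \<longrightarrow> l \<ge> 2 \<longrightarrow>
       bgr k (path_graph 4) (disjoint_union (path_graph r) (path_graph (r + l)))
         = k * (r div 2 + (r + l) div 2) - k + 1) \<and>
    (\<forall>l1 l2 :: nat. l1 \<ge> 2 \<longrightarrow> l2 \<ge> 2 \<longrightarrow>
       bgr k (path_graph 4) (disjoint_union (cycle_graph (2 * l1)) (cycle_graph (2 * l2)))
         = k * (l1 + l2) - k + 1) \<and>
    (\<forall>m l :: nat. m \<ge> 2 \<longrightarrow> l \<ge> 2 \<longrightarrow>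
       bgr k (path_graph 4) (disjoint_union (path_graph m) (cycle_graph (2 * l)))
         = k * (l + m div 2) - k + 1)"
proof (intro conjI allI impI)
  fix r l :: nat assume "2 \<le> r" "2 \<le> l"
  then show "bgr k (path_graph 4) (disjoint_union (path_graph r) (path_graph (r + l)))
      = k * (r div 2 + (r + l) div 2) - k + 1"
    by (intro bgr_P4_nearly_balanced[OF saturating_bipartition_disjoint_union[OF
          saturating_bipartition_path saturating_bipartition_path] assms]) linarith+
next
  fix l1 l2 :: nat assume "2 \<le> l1" "2 \<le> l2"
  then show "bgr k (path_graph 4) (disjoint_union (cycle_graph (2 * l1)) (cycle_graph (2 * l2)))
      = k * (l1 + l2) - k + 1"
    by (intro bgr_P4_nearly_balanced[OF saturating_bipartition_disjoint_union[OF
          saturating_bipartition_cycle saturating_bipartition_cycle] assms]) linarith+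
next
  fix m l :: nat assume "2 \<le> m" "2 \<le> l"
  then have "bgr k (path_graph 4) (disjoint_union (path_graph m) (cycle_graph (2 * l)))
      = k * (m div 2 + l) - k + 1"
    by (intro bgr_P4_nearly_balanced[OF saturating_bipartition_disjoint_union[OF
          saturating_bipartition_path saturating_bipartition_cycle] assms]) linarith+
  then show "bgr k (path_graph 4) (disjoint_union (path_graph m) (cycle_graph (2 * l)))
      = k * (l + m div 2) - k + 1"
    by (simp add: add.commute)
qed

end
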